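(* For every $0<\alpha<1$, the limit $L(\alpha)=\lim_{n\to\infty}n^{1-\alpha}g_n(\alpha)$ satisfies $$L(\alpha)=\frac{2^{\alpha-1}}{\Gamma(\alpha+1)}.$$
   Context: Let $\mathbb{D}$ be the open unit disk in $\mathbb{C}$. For $\alpha\in(0,1)$ let $f_\alpha(z)=\frac{1}{2\alpha}\left(\left(\frac{1+z}{1-z}\right)^\alpha-1\right)$, $z\in\mathbb{D}$ (principal branch of the power), and let $\{g_n(\alpha)\}_{n\ge 0}$ be its sequence of Taylor coefficients at the origin, i.e. $f_\alpha(z)=\sum_{n\ge0}g_n(\alpha)z^n$. $\Gamma$ denotes the Euler Gamma function. The limit $L(\alpha):=\lim_{n\to\infty}n^{1-\alpha}g_n(\alpha)$ exists for every $\alpha\in(0,1)$. *)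

theory Defs
  imports "HOL-Complex_Analysis.Complex_Analysis"
begin

text \<open>Complex \<open>powr\<close> with exponent \<open>\<alpha>\<close> is the principal branch. The function is total here,
  but only its values on the open unit disk \<open>ball 0 1\<close> matter; there \<open>(1 + z) / (1 - z)\<close> has
  positive real part, so the branch cut is avoided.\<close>

definition f_alpha :: "real \<Rightarrow> complex \<Rightarrow> complex" where
  "f_alpha \<alpha> z = 1 / (2 * of_real \<alpha>) * (((1 + z) / (1 - z)) powr of_real \<alpha> - 1)"

definition g_coeff :: "nat \<Rightarrow> real \<Rightarrow> complex" where
  "g_coeff n \<alpha> = (deriv ^^ n) (f_alpha \<alpha>) 0 / fact n"

lemma Re_moebius_pos:
  assumes "norm z < 1"
  shows "Re ((1 + z) / (1 - z)) > 0"
proof -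
  have "(Re z)\<^sup>2 + (Im z)\<^sup>2 < 1"
    using assms by (simp add: cmod_def)
  moreover have "z \<noteq> 1" using assms by auto
  then have "(Re (1 - z))\<^sup>2 + (Im (1 - z))\<^sup>2 > 0"
    by (metis complex_eq_iff eq_iff_diff_eq_0 sum_power2_gt_zero_iff zero_complex.sel)
  ultimately show ?thesis
    by (simp add: Re_divide power2_eq_square algebra_simps)
qed

lemma f_alpha_holomorphic: "f_alpha \<alpha> holomorphic_on ball 0 1"
proof -
  have "(1 + z) / (1 - z) \<notin> \<real>\<^sub>\<le>\<^sub>0" if "z \<in> ball 0 1" for z :: complex
    using Re_moebius_pos[of z] that by (auto simp: complex_nonpos_Reals_iff)
  moreover have "1 - z \<noteq> 0" if "z \<in> ball 0 1" for z :: complex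
    using that by auto
  ultimately show ?thesis
    unfolding f_alpha_def by (intro holomorphic_intros) auto
qed

lemma f_alpha_sums:
  assumes "z \<in> ball 0 1"
  shows "(\<lambda>n. g_coeff n \<alpha> * z ^ n) sums f_alpha \<alpha> z"
  using holomorphic_power_series[OF f_alpha_holomorphic assms] by (simp add: g_coeff_def)

end

theory Submission
  imports Defs
begin

text \<open>
  Near the origin \<open>((1 + z) / (1 - z)) powr \<alpha>\<close> factors as \<open>(1 + z) powr \<alpha> * (1 - z) powr (-\<alpha>)\<close>, so its
  \<open>n\<close>-th Taylor coefficient is the convolution \<open>c\<^sub>n = (\<Sum>k\<le>n. a\<^sub>k * b\<^bsub>n - k\<^esub>)\<close> of the binomial coefficients
  \<open>a\<^sub>k = \<alpha> gchoose k\<close> with the rising binomial coefficients \<open>b\<^sub>m = pochhammer \<alpha> m / fact m\<close>.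
  The singularity at \<open>z = 1\<close> dominates: the \<open>a\<^sub>k\<close> are absolutely summable with sum \<open>2 powr \<alpha>\<close>, while
  \<open>b\<^sub>m\<close> behaves like \<open>m powr (\<alpha> - 1) / Gamma \<alpha>\<close>. Hence \<open>c\<^sub>n\<close> should behave like
  \<open>2 powr \<alpha> * n powr (\<alpha> - 1) / Gamma \<alpha>\<close>, and dividing by \<open>2 * \<alpha>\<close> gives the limit.

  The limit cannot be taken under the sum directly, because \<open>b\<^sub>m\<close> decreases, so that
  \<open>b\<^bsub>n - k\<^esub> / b\<^sub>n\<close> is not bounded uniformly in \<open>k \<le> n\<close>. Multiplying by \<open>n = (n - k) + k\<close> removes the difficulty:
  \<open>n * c\<^sub>n\<close> is the sum of \<open>S\<^sub>n = (\<Sum>k\<le>n. a\<^sub>k * ((n - k) * b\<^bsub>n - k\<^esub>))\<close> and \<open>E\<^sub>n = (\<Sum>k\<le>n. k * a\<^sub>k * b\<^bsub>n - k\<^esub>)\<close>.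
  The sequence \<open>m * b\<^sub>m\<close> is increasing and asymptotic to \<open>m powr \<alpha> / Gamma \<alpha>\<close>, so Tannery's theorem applies to \<open>S\<^sub>n\<close>
  (\<open>convolution_mono_asymptotic\<close>). The error \<open>E\<^sub>n\<close> is bounded by \<open>\<alpha>\<close>: after taking absolute
  values, Vandermonde's identity evaluates the sum exactly (\<open>abs_sum_index_times_gbinomial_le\<close>). Dividing by \<open>n powr \<alpha>\<close>
  therefore leaves only the contribution of \<open>S\<^sub>n\<close>.
\<close>

section \<open>Rising binomial coefficients\<close>

text \<open>The coefficient of \<open>z ^ n\<close> in \<open>(1 - z) powr (-s)\<close>; it is nonnegative for \<open>s > 0\<close>.\<close>

definition rising_binomial :: "real \<Rightarrow> nat \<Rightarrow> real" where
  "rising_binomial s n = pochhammer s n / fact n"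

lemma rising_binomial_0 [simp]: "rising_binomial s 0 = 1"
  by (simp add: rising_binomial_def)

lemma rising_binomial_1 [simp]: "rising_binomial 1 n = 1"
  by (simp add: rising_binomial_def flip: pochhammer_fact)

lemma rising_binomial_nonneg: "s > 0 \<Longrightarrow> rising_binomial s n \<ge> 0"
  by (simp add: rising_binomial_def pochhammer_nonneg)

lemma rising_binomial_Suc: "real (Suc n) * rising_binomial s (Suc n) = (s + real n) * rising_binomial s n"
  by (simp add: rising_binomial_def pochhammer_rec' field_simps del: of_nat_Suc)

lemma rising_binomial_absorption:
  "real (Suc n) * rising_binomial s (Suc n) = s * rising_binomial (s + 1) n"
  by (simp add: rising_binomial_def pochhammer_rec field_simps del: of_nat_Suc)

lemma gbinomial_eq_rising_binomial: "s gchoose n = (-1) ^ n * rising_binomial (-s) n"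
  by (simp add: rising_binomial_def gbinomial_pochhammer)

text \<open>This compares coefficients in \<open>(1 - z) powr (-s) * (1 - z) powr (-t) = (1 - z) powr (-(s + t))\<close>; the signs
  cancel in Vandermonde's identity with the upper arguments \<open>-s\<close> and \<open>-t\<close>.\<close>

lemma rising_binomial_Vandermonde:
  "(\<Sum>k\<le>n. rising_binomial s k * rising_binomial t (n - k)) = rising_binomial (s + t) n"
proof -
  have eq: "rising_binomial u k = (-1) ^ k * ((-u) gchoose k)" for u k
    by (simp add: gbinomial_eq_rising_binomial flip: mult.assoc power_mult_distrib)
  have "(\<Sum>k\<le>n. rising_binomial s k * rising_binomial t (n - k)) =
        (\<Sum>k\<le>n. (-1) ^ n * (((-s) gchoose k) * ((-t) gchoose (n - k))))"
    by (intro sum.cong refl) (simp add: eq mult_ac flip: power_add)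
  also have "\<dots> = (-1) ^ n * ((-s + -t) gchoose n)"
    by (simp add: gbinomial_Vandermonde atMost_atLeast0 flip: sum_distrib_left)
  finally show ?thesis
    by (simp add: eq)
qed

text \<open>One step of the recurrence multiplies \<open>rising_binomial s n\<close> by \<open>s + n\<close>, which is more than the factor \<open>n\<close> present
  before. This monotonicity provides the domination in the convolution below.\<close>

lemma mono_times_rising_binomial:
  assumes "s > 0"
  shows   "mono (\<lambda>n. real n * rising_binomial s n)"
proof (rule incseq_SucI)
  fix n
  show "real n * rising_binomial s n \<le> real (Suc n) * rising_binomial s (Suc n)"
    unfolding rising_binomial_Suc
    using assms by (intro mult_right_mono rising_binomial_nonneg) auto
qed

text \<open>The product \<open>(n + 1) * rising_binomial s (n + 1)\<close>, divided by \<open>n powr s\<close>, is the \<open>n\<close>-th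
  approximant in Euler's product formula for \<open>1 / Gamma s\<close>. A shift of the index by a fixed \<open>k\<close>
  leaves the power \<open>n powr s\<close> asymptotically unchanged.\<close>

lemma times_rising_binomial_asymptotic:
  "(\<lambda>n. real (n - k) * rising_binomial s (n - k) / real n powr s) \<longlonglongrightarrow> rGamma s"
  \<comment> \<open>The offset turns \<open>n - k\<close> into \<open>n + 1\<close>, the index that occurs in Euler's product.\<close>
proof (rule LIMSEQ_offset[where k = "Suc k"])
  let ?r = "\<lambda>n. real n powr s / real (n + Suc k) powr s"
  have ev: "eventually (\<lambda>n. rGamma_series s n * ?r n =
          real (n + Suc k - k) * rising_binomial s (n + Suc k - k) / real (n + Suc k) powr s) sequentially"
    using eventually_gt_at_top[of 0]
  proof eventually_elim
    case (elim n)
    have "rGamma_series s n = real (Suc n) * rising_binomial s (Suc n) / real n powr s"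
      using elim by (simp add: rGamma_series_def rising_binomial_def powr_def field_simps del: of_nat_Suc)
    thus ?case
      using elim by simp
  qed
  have "?r \<longlonglongrightarrow> 1"
    by real_asymp
  hence "(\<lambda>n. rGamma_series s n * ?r n) \<longlonglongrightarrow> rGamma s * 1"
    by (intro tendsto_mult rGamma_series_LIMSEQ)
  thus "(\<lambda>n. real (n + Suc k - k) * rising_binomial s (n + Suc k - k) / real (n + Suc k) powr s)
          \<longlonglongrightarrow> rGamma s"
    using tendsto_cong[OF ev] by simp
qed

section \<open>The binomial series at the point 1\<close>

text \<open>Except for the constant one, all coefficients of \<open>(1 - z) powr \<alpha>\<close> are nonpositive, so the partial sums of the
  absolute values have a closed form:
  by Vandermonde's identity with \<open>t = 1\<close> they equal \<open>2 - rising_binomial (1 - \<alpha>) n\<close>.\<close>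

lemma summable_abs_gbinomial:
  fixes \<alpha> :: real
  assumes "0 < \<alpha>" "\<alpha> < 1"
  shows   "summable (\<lambda>k. \<bar>\<alpha> gchoose k\<bar>)"
proof (rule summableI_nonneg_bounded)
  have neg: "\<bar>rising_binomial (-\<alpha>) (Suc k)\<bar> = - rising_binomial (-\<alpha>) (Suc k)" for k
  proof -
    have "rising_binomial (-\<alpha>) (Suc k) = - (\<alpha> * rising_binomial (1 - \<alpha>) k / real (Suc k))"
      using rising_binomial_absorption[of k "-\<alpha>"] by (simp add: field_simps del: of_nat_Suc)
    also have "\<dots> \<le> 0"
      using assms rising_binomial_nonneg[of "1 - \<alpha>" k] by simp
    finally show ?thesis
      by simp
  qed
  have bound: "(\<Sum>k\<le>n. \<bar>\<alpha> gchoose k\<bar>) \<le> 2" for n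
  proof -
    have "(\<Sum>k\<le>n. \<bar>\<alpha> gchoose k\<bar>) = (\<Sum>k\<le>n. \<bar>rising_binomial (-\<alpha>) k\<bar>)"
      by (simp add: gbinomial_eq_rising_binomial abs_mult power_abs)
    also have "\<dots> = 1 + (\<Sum>k<n. \<bar>rising_binomial (-\<alpha>) (Suc k)\<bar>)"
      by (subst sum.atMost_shift) simp
    also have "(\<Sum>k<n. \<bar>rising_binomial (-\<alpha>) (Suc k)\<bar>) = 1 - (\<Sum>k\<le>n. rising_binomial (-\<alpha>) k)"
      by (subst sum.atMost_shift) (simp add: neg sum_negf)
    also have "(\<Sum>k\<le>n. rising_binomial (-\<alpha>) k) = rising_binomial (1 - \<alpha>) n"
      using rising_binomial_Vandermonde[of "-\<alpha>" 1 n] by simp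
    finally show ?thesis
      using rising_binomial_nonneg[of "1 - \<alpha>" n] assms by simp
  qed
  show "(\<Sum>k<n. \<bar>\<alpha> gchoose k\<bar>) \<le> 2" for n
    by (rule order.trans[OF sum_mono2 bound[of n]]) auto
qed auto

text \<open>The binomial theorem holds on \<open>(0, 1)\<close>; absolute summability of the coefficients allows the passage to the boundary
  point \<open>x = 1\<close>, in the manner of Abel's limit theorem.\<close>

lemma suminf_gbinomial:
  fixes \<alpha> :: real
  assumes "0 < \<alpha>" "\<alpha> < 1"
  shows   "(\<Sum>k. \<alpha> gchoose k) = 2 powr \<alpha>"
proof (rule tendsto_unique)
  let ?F = "at_left (1 :: real)"
  have ev: "eventually (\<lambda>x. x \<in> {0<..<1}) ?F"
    by (rule eventually_at_leftI[of 0]) auto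
  have "eventually (\<lambda>(k, x). norm ((\<alpha> gchoose k) * x ^ k) \<le> \<bar>\<alpha> gchoose k\<bar>) (at_top \<times>\<^sub>F ?F)"
    using eventually_compose_filterlim[OF ev filterlim_snd]
    by (rule eventually_mono) (auto simp: abs_mult power_abs intro!: mult_left_le power_le_one)
  moreover have "((\<lambda>x. (\<alpha> gchoose k) * x ^ k) \<longlongrightarrow> (\<alpha> gchoose k)) ?F" for k
    by (auto intro!: tendsto_eq_intros)
  ultimately show "((\<lambda>x. \<Sum>k. (\<alpha> gchoose k) * x ^ k) \<longlongrightarrow> (\<Sum>k. \<alpha> gchoose k)) ?F"
    using tannerys_theorem[of "\<lambda>k x. (\<alpha> gchoose k) * x ^ k" "\<lambda>k. \<alpha> gchoose k" ?F
        "\<lambda>k. \<bar>\<alpha> gchoose k\<bar>"] summable_abs_gbinomial[OF assms] by simp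
  have "((\<lambda>x. (1 + x) powr \<alpha>) \<longlongrightarrow> 2 powr \<alpha>) ?F"
    by (auto intro!: tendsto_eq_intros)
  moreover have "eventually (\<lambda>x. (1 + x) powr \<alpha> = (\<Sum>k. (\<alpha> gchoose k) * x ^ k)) ?F"
    using ev by eventually_elim (auto intro!: sums_unique gen_binomial_real)
  ultimately show "((\<lambda>x. \<Sum>k. (\<alpha> gchoose k) * x ^ k) \<longlongrightarrow> 2 powr \<alpha>) ?F"
    by (rule Lim_transform_eventually)
qed auto

section \<open>A limit theorem for convolutions\<close>

text \<open>Since \<open>p\<close> is increasing, \<open>p (n - k) / w n \<le> p n / w n\<close>, and the right-hand side is a convergent, hence bounded,
  sequence. So \<open>\<bar>a k\<bar>\<close> times a constant dominates the terms, and Tannery's theorem gives the limit.\<close>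

lemma convolution_mono_asymptotic:
  fixes a p w :: "nat \<Rightarrow> real"
  assumes a: "summable (\<lambda>k. \<bar>a k\<bar>)"
    and p: "mono p" "\<And>n. p n \<ge> 0"
    and w: "\<And>n. w n \<ge> 0"
    and lim: "\<And>k. (\<lambda>n. p (n - k) / w n) \<longlonglongrightarrow> L"
  shows "(\<lambda>n. (\<Sum>k\<le>n. a k * p (n - k)) / w n) \<longlonglongrightarrow> L * (\<Sum>k. a k)"
proof -
  define t where "t = (\<lambda>k n. if k \<le> n then a k * (p (n - k) / w n) else 0)"
  have "Bseq (\<lambda>n. p (n - 0) / w n)"
    using lim[of 0] by (intro convergent_imp_Bseq) (auto simp: convergent_def)
  then obtain C where C: "\<And>n. \<bar>p n / w n\<bar> \<le> C"
    by (auto simp: Bseq_def)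
  have bound: "norm (t k n) \<le> \<bar>a k\<bar> * C" for k n
  proof (cases "k \<le> n")
    case True
    have "p (n - k) / w n \<le> p n / w n"
      using monoD[OF p(1), of "n - k" n] w[of n] by (simp add: divide_right_mono)
    also have "\<dots> \<le> C"
      using order.trans[OF abs_ge_self C[of n]] .
    finally have "\<bar>p (n - k) / w n\<bar> \<le> C"
      using p(2)[of "n - k"] w[of n] by simp
    hence "\<bar>a k\<bar> * \<bar>p (n - k) / w n\<bar> \<le> \<bar>a k\<bar> * C"
      by (rule mult_left_mono) simp
    with True show ?thesis
      by (simp add: t_def abs_mult)
  next
    case False
    moreover have "C \<ge> 0"
      using C[of 0] by linarith
    ultimately show ?thesis
      by (simp add: t_def)
  qed
  have "(\<lambda>n. t k n) \<longlonglongrightarrow> a k * L" for k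
  proof (rule Lim_transform_eventually)
    show "(\<lambda>n. a k * (p (n - k) / w n)) \<longlonglongrightarrow> a k * L"
      by (intro tendsto_intros lim)
    show "eventually (\<lambda>n. a k * (p (n - k) / w n) = t k n) sequentially"
      using eventually_ge_at_top[of k] by eventually_elim (simp add: t_def)
  qed
  moreover have "eventually (\<lambda>(k, n). norm (t k n) \<le> \<bar>a k\<bar> * C) (at_top \<times>\<^sub>F sequentially)"
    using bound by (intro always_eventually) auto
  moreover have "summable (\<lambda>k. \<bar>a k\<bar> * C)"
    using a by (rule summable_mult2)
  ultimately have "(\<lambda>n. \<Sum>k. t k n) \<longlonglongrightarrow> (\<Sum>k. a k * L)"
    using tannerys_theorem[of t "\<lambda>k. a k * L" sequentially "\<lambda>k. \<bar>a k\<bar> * C"] by simp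
  also have "(\<Sum>k. a k * L) = L * (\<Sum>k. a k)"
    using suminf_mult2[OF summable_rabs_cancel[OF a], of L] by (simp add: mult.commute)
  also have "(\<lambda>n. \<Sum>k. t k n) = (\<lambda>n. (\<Sum>k\<le>n. a k * p (n - k)) / w n)"
  proof
    fix n
    have "(\<Sum>k. t k n) = (\<Sum>k\<le>n. t k n)"
      by (rule suminf_finite) (auto simp: t_def)
    thus "(\<Sum>k. t k n) = (\<Sum>k\<le>n. a k * p (n - k)) / w n"
      by (simp add: t_def sum_divide_distrib)
  qed
  finally show ?thesis .
qed

section \<open>Asymptotics of the coefficients\<close>

definition moebius_power_coeff :: "real \<Rightarrow> nat \<Rightarrow> real" where
  "moebius_power_coeff \<alpha> n = (\<Sum>k\<le>n. (\<alpha> gchoose k) * rising_binomial \<alpha> (n - k))"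

text \<open>For \<open>k > 0\<close>, absorption gives \<open>k * \<bar>\<alpha> gchoose k\<bar> = \<alpha> * rising_binomial (1 - \<alpha>) (k - 1)\<close>. Convolving with \<open>rising_binomial \<alpha>\<close> then gives
  the coefficients of \<open>\<alpha> / (1 - z)\<close>, all equal to \<open>\<alpha>\<close>.\<close>

lemma abs_sum_index_times_gbinomial_le:
  assumes "0 < \<alpha>" "\<alpha> < 1"
  shows   "\<bar>\<Sum>k\<le>n. real k * (\<alpha> gchoose k) * rising_binomial \<alpha> (n - k)\<bar> \<le> \<alpha>"
proof (cases n)
  case 0
  thus ?thesis using assms by simp
next
  case (Suc m)
  have "\<bar>\<Sum>k\<le>n. real k * (\<alpha> gchoose k) * rising_binomial \<alpha> (n - k)\<bar> =
        \<bar>\<Sum>k\<le>m. real (Suc k) * (\<alpha> gchoose (Suc k)) * rising_binomial \<alpha> (m - k)\<bar>"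
    unfolding Suc by (subst sum.atMost_Suc_shift) simp
  also have "\<dots> \<le> (\<Sum>k\<le>m. \<bar>real (Suc k) * (\<alpha> gchoose (Suc k)) * rising_binomial \<alpha> (m - k)\<bar>)"
    by (rule sum_abs)
  also have "\<dots> = (\<Sum>k\<le>m. \<alpha> * (rising_binomial (1 - \<alpha>) k * rising_binomial \<alpha> (m - k)))"
  proof (rule sum.cong)
    fix k
    have "\<bar>real (Suc k) * (\<alpha> gchoose (Suc k))\<bar> = \<bar>real (Suc k) * rising_binomial (-\<alpha>) (Suc k)\<bar>"
      by (simp add: gbinomial_eq_rising_binomial abs_mult power_abs)
    also have "\<dots> = \<alpha> * rising_binomial (1 - \<alpha>) k"
      unfolding rising_binomial_absorption
      using assms rising_binomial_nonneg[of "1 - \<alpha>" k] by (simp add: abs_mult)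
    finally show "\<bar>real (Suc k) * (\<alpha> gchoose (Suc k)) * rising_binomial \<alpha> (m - k)\<bar> =
        \<alpha> * (rising_binomial (1 - \<alpha>) k * rising_binomial \<alpha> (m - k))"
      using rising_binomial_nonneg[of \<alpha> "m - k"] assms by (simp add: abs_mult mult_ac)
  qed auto
  also have "\<dots> = \<alpha>"
    using rising_binomial_Vandermonde[of "1 - \<alpha>" \<alpha> m] by (simp flip: sum_distrib_left)
  finally show ?thesis .
qed

lemma moebius_power_coeff_asymptotic:
  assumes "0 < \<alpha>" "\<alpha> < 1"
  shows   "(\<lambda>n. real n powr (1 - \<alpha>) * moebius_power_coeff \<alpha> n) \<longlonglongrightarrow> 2 powr \<alpha> / Gamma \<alpha>"
proof -
  define S where "S = (\<lambda>n. \<Sum>k\<le>n. (\<alpha> gchoose k) * (real (n - k) * rising_binomial \<alpha> (n - k)))"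
  define E where "E = (\<lambda>n. \<Sum>k\<le>n. real k * (\<alpha> gchoose k) * rising_binomial \<alpha> (n - k))"
  have split: "real n * moebius_power_coeff \<alpha> n = S n + E n" for n
    unfolding moebius_power_coeff_def S_def E_def sum_distrib_left sum.distrib [symmetric]
    by (intro sum.cong refl) (auto simp: of_nat_diff algebra_simps)
  have "(\<lambda>n. S n / real n powr \<alpha>) \<longlonglongrightarrow> rGamma \<alpha> * (\<Sum>k. \<alpha> gchoose k)"
    unfolding S_def
    using assms by (intro convolution_mono_asymptotic summable_abs_gbinomial
        mono_times_rising_binomial times_rising_binomial_asymptotic)
      (auto intro: rising_binomial_nonneg mult_nonneg_nonneg)
  moreover have "(\<lambda>n. E n / real n powr \<alpha>) \<longlonglongrightarrow> 0"
  proof (rule Lim_null_comparison)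
    show "eventually (\<lambda>n. norm (E n / real n powr \<alpha>) \<le> \<alpha> / real n powr \<alpha>) sequentially"
      using abs_sum_index_times_gbinomial_le[OF assms]
      by (auto simp: E_def intro!: always_eventually divide_right_mono)
    show "(\<lambda>n. \<alpha> / real n powr \<alpha>) \<longlonglongrightarrow> 0"
      using assms by real_asymp
  qed
  ultimately have "(\<lambda>n. S n / real n powr \<alpha> + E n / real n powr \<alpha>) \<longlonglongrightarrow>
      rGamma \<alpha> * (\<Sum>k. \<alpha> gchoose k) + 0"
    by (rule tendsto_add)
  moreover have "S n / real n powr \<alpha> + E n / real n powr \<alpha> =
      real n powr (1 - \<alpha>) * moebius_power_coeff \<alpha> n" for n
    using split[of n] by (cases "n = 0") (simp_all add: powr_diff flip: add_divide_distrib)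
  ultimately show ?thesis
    by (simp add: suminf_gbinomial[OF assms] rGamma_inverse_Gamma field_simps)
qed

section \<open>Taylor expansion of the function\<close>

text \<open>The arguments of \<open>x\<close> and \<open>y\<close> lie strictly between \<open>-pi / 2\<close> and \<open>pi / 2\<close>, so their difference is still a principal
  argument and no multiple of \<open>2 * pi\<close> enters the logarithm of the quotient.\<close>

lemma powr_divide_right_half_plane:
  assumes "Re x > 0" "Re y > 0"
  shows   "(x / y) powr c = x powr c * y powr (-c)"
proof -
  have [simp]: "x \<noteq> 0" "y \<noteq> 0"
    using assms by auto
  have "\<bar>Im (Ln x)\<bar> < pi / 2" "\<bar>Im (Ln y)\<bar> < pi / 2"
    using assms by (simp_all only: Re_Ln_pos_lt_imp)
  hence "- pi < Im (Ln x - Ln y)" "Im (Ln x - Ln y) \<le> pi"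
    unfolding minus_complex.sel by linarith+
  hence "Ln (x / y) = Ln x - Ln y"
    by (intro Ln_unique) (auto simp: exp_diff)
  thus ?thesis
    by (simp add: powr_def right_diff_distrib exp_diff exp_minus divide_inverse)
qed

lemma has_fps_expansion_one_minus_powr:
  "(\<lambda>z::complex. (1 - z) powr (- of_real \<alpha>)) has_fps_expansion
     Abs_fps (\<lambda>n. of_real (rising_binomial \<alpha> n))"
proof (rule has_fps_expansionI)
  have "(\<lambda>n. of_real (rising_binomial \<alpha> n) * z ^ n) sums (1 - z) powr (- of_real \<alpha>)"
    if "norm z < 1" for z :: complex
  proof -
    have "(\<lambda>n. ((- of_real \<alpha>) gchoose n) * (-z) ^ n) sums (1 + (-z)) powr (- of_real \<alpha>)"
      using that by (intro gen_binomial_complex) auto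
    moreover have "((- of_real \<alpha>) gchoose n) * (-z) ^ n = of_real (rising_binomial \<alpha> n) * z ^ n" for n
      by (simp add: gbinomial_pochhammer rising_binomial_def pochhammer_of_real
               flip: power_mult_distrib)
    ultimately show ?thesis
      by simp
  qed
  moreover have "eventually (\<lambda>z::complex. z \<in> ball 0 1) (nhds 0)"
    by (intro eventually_nhds_in_open) auto
  ultimately show "eventually (\<lambda>z::complex. (\<lambda>n. Abs_fps (\<lambda>n. of_real (rising_binomial \<alpha> n)) $ n * z ^ n)
      sums (1 - z) powr (- of_real \<alpha>)) (nhds 0)"
    by (auto elim!: eventually_mono)
qed

lemma has_fps_expansion_moebius_power:
  "(\<lambda>z::complex. ((1 + z) / (1 - z)) powr of_real \<alpha>) has_fps_expansion
     Abs_fps (\<lambda>n. of_real (moebius_power_coeff \<alpha> n))"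
proof -
  have gbin: "(complex_of_real \<alpha> gchoose k) = of_real (\<alpha> gchoose k)" for k
    by (simp add: gbinomial_pochhammer flip: pochhammer_of_real)
  have eq: "fps_binomial (complex_of_real \<alpha>) * Abs_fps (\<lambda>n. of_real (rising_binomial \<alpha> n)) =
      Abs_fps (\<lambda>n. of_real (moebius_power_coeff \<alpha> n))"
    by (simp add: fps_eq_iff fps_mult_nth moebius_power_coeff_def gbin atMost_atLeast0)
  have "(\<lambda>z::complex. (1 + z) powr of_real \<alpha> * (1 - z) powr (- of_real \<alpha>)) has_fps_expansion
      Abs_fps (\<lambda>n. of_real (moebius_power_coeff \<alpha> n))"
    unfolding eq [symmetric]
    by (intro has_fps_expansion_mult has_fps_expansion_binomial_complex
        has_fps_expansion_one_minus_powr)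
  also have "?this \<longleftrightarrow> ?thesis"
  proof (rule has_fps_expansion_cong)
    have "eventually (\<lambda>z::complex. z \<in> ball 0 1) (nhds 0)"
      by (intro eventually_nhds_in_open) auto
    thus "eventually (\<lambda>z::complex. (1 + z) powr of_real \<alpha> * (1 - z) powr (- of_real \<alpha>) =
        ((1 + z) / (1 - z)) powr of_real \<alpha>) (nhds 0)"
    proof eventually_elim
      case (elim z)
      hence "\<bar>Re z\<bar> < 1"
        using abs_Re_le_cmod[of z] by simp
      thus ?case
        by (subst powr_divide_right_half_plane) auto
    qed
  qed auto
  finally show ?thesis .
qed

text \<open>The index \<open>n = 0\<close> is exceptional because of the subtracted constant \<open>1\<close> in \<open>f_alpha\<close>.\<close>

lemma g_coeff_eq:
  assumes "n > 0"
  shows   "g_coeff n \<alpha> = of_real (moebius_power_coeff \<alpha> n / (2 * \<alpha>))"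
proof -
  have "f_alpha \<alpha> has_fps_expansion
      fps_const (1 / (2 * of_real \<alpha>)) * (Abs_fps (\<lambda>n. of_real (moebius_power_coeff \<alpha> n)) - 1)"
    unfolding f_alpha_def
    by (intro has_fps_expansion_cmult_left has_fps_expansion_diff has_fps_expansion_1
        has_fps_expansion_moebius_power)
  from fps_nth_fps_expansion[OF this, of n] show ?thesis
    using assms by (simp add: g_coeff_def)
qed

theorem theorem2p2:
  fixes \<alpha> :: real
  assumes "0 < \<alpha>" and "\<alpha> < 1"
  shows "(\<lambda>n. of_real (real n powr (1 - \<alpha>)) * g_coeff n \<alpha>)
           \<longlonglongrightarrow> of_real (2 powr (\<alpha> - 1) / Gamma (\<alpha> + 1))"
proof -
  have "(\<lambda>n. real n powr (1 - \<alpha>) * moebius_power_coeff \<alpha> n / (2 * \<alpha>)) \<longlonglongrightarrow>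
      2 powr \<alpha> / Gamma \<alpha> / (2 * \<alpha>)"
    using assms by (intro tendsto_divide moebius_power_coeff_asymptotic tendsto_const) auto
  also have "2 powr \<alpha> / Gamma \<alpha> / (2 * \<alpha>) = 2 powr (\<alpha> - 1) / Gamma (\<alpha> + 1)"
  proof -
    have "\<alpha> \<notin> \<int>\<^sub>\<le>\<^sub>0"
      using assms by (auto elim!: nonpos_Ints_cases)
    thus ?thesis
      by (simp add: Gamma_plus1 powr_diff)
  qed
  finally have "(\<lambda>n. complex_of_real (real n powr (1 - \<alpha>) * moebius_power_coeff \<alpha> n / (2 * \<alpha>)))
      \<longlonglongrightarrow> of_real (2 powr (\<alpha> - 1) / Gamma (\<alpha> + 1))"
    by (rule tendsto_of_real)
  moreover have "eventually (\<lambda>n. complex_of_real (real n powr (1 - \<alpha>) * moebius_power_coeff \<alpha> n / (2 * \<alpha>)) =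
      of_real (real n powr (1 - \<alpha>)) * g_coeff n \<alpha>) sequentially"
    using eventually_gt_at_top[of 0] by eventually_elim (simp add: g_coeff_eq)
  ultimately show ?thesis
    by (rule Lim_transform_eventually)
qed

end
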